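(* Let $(G,H,\mathcal{L})$ be a cut and project scheme, where $G$ is a second countable locally compact Abelian group, let $W\subseteq H$ be compact, and let $f:G\to\mathbb{C}$ be a function which vanishes outside $\Lambda(W)$. Let $$\gamma=\sum_{x\in\Lambda(W)}f(x)\,\delta_x,\qquad \eta=\sum_{(x,x^\star)\in\mathcal{L}}f(x)\,\delta_{(x,x^\star)}.$$ Then $\gamma$ is a positive definite measure on $G$ if and only if $\eta$ is a positive definite measure on $G\times H$.
   Context: Cut and project scheme (CPS): a triple $(G,H,\mathcal{L})$ consisting of a $\sigma$-compact locally compact Abelian group (LCAG) $G$, an LCAG $H$, and a lattice (discrete co-compact subgroup) $\mathcal{L}\subset G\times H$ such that, with $\pi_G,\pi_H$ the canonical projections of $G\times H$, (i) $\pi_H(\mathcal{L})$ is dense in $H$, and (ii) $\pi_G|_{\mathcal{L}}$ is one to one. Put $L:=\pi_G(\mathcal{L})$. The $\star$-map $\star:L\to H$, $x\mapsto x^\star$, is the composition of the inverse of $\pi_G|_{\mathcal{L}}:\mathcal{L}\to L$ with $\pi_H$, so $\mathcal{L}=\{(x,x^\star):x\in L\}$. For $W\subseteq H$ put $\Lambda(W):=\{x\in L:x^\star\in W\}$; when $W$ is compact this is called a weak model set, and it is uniformly discrete in $G$. For an LCAG $X$, $C_{\mathsf{c}}(X)$ is the space of compactly supported continuous functions $X\to\mathbb{C}$. A measure on $X$ is a complex Radon measure: a linear functional $\mu:C_{\mathsf{c}}(X)\to\mathbb{C}$ such that for each compact $K\subseteq X$ there is a constant $C_K$ with $|\mu(\varphi)|\le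 C_K\|\varphi\|_\infty$ for all $\varphi\in C_{\mathsf{c}}(X)$ with $\operatorname{supp}(\varphi)\subseteq K$. $\delta_x$ is the unit point mass at $x$. A measure $\mu$ on $X$ is positive definite if $\mu(\varphi*\widetilde{\varphi})\ge 0$ for all $\varphi\in C_{\mathsf{c}}(X)$, where $\widetilde{\varphi}(x)=\overline{\varphi(-x)}$ and $*$ is convolution with respect to Haar measure. *)

theory Defs
  imports "HOL-Analysis.Analysis"
begin

section \<open>Locally compact Abelian groups\<close>

text \<open>As usual, the Hausdorff property is part of the notion of an LCAG.\<close>

class lcag = topological_ab_group_add + t2_space +
  assumes locally_compact: "\<exists>U K. open U \<and> compact K \<and> x \<in> U \<and> U \<subseteq> K"

lemma locally_compact_space_lcag: "locally_compact_space (euclidean :: 'a::lcag topology)"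
  unfolding locally_compact_space_def
  using locally_compact by fastforce

instance prod :: (topological_monoid_add, topological_monoid_add) topological_monoid_add
proof
  fix a b :: "'a \<times> 'b"
  have 1: "(fst \<longlongrightarrow> a) (nhds a \<times>\<^sub>F nhds b)" and 2: "(snd \<longlongrightarrow> b) (nhds a \<times>\<^sub>F nhds b)"
    by (rule filterlim_fst, rule filterlim_snd)
  show "((\<lambda>p. fst p + snd p) \<longlongrightarrow> a + b) (nhds a \<times>\<^sub>F nhds b)"
    unfolding plus_prod_def
    by (intro tendsto_Pair tendsto_add tendsto_fst tendsto_snd 1 2)
qed

instance prod :: (topological_group_add, topological_group_add) topological_group_add
proof
  fix a :: "'a \<times> 'b"
  have "((\<lambda>x. (- fst x, - snd x)) \<longlongrightarrow> (- fst a, - snd a)) (nhds a)"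
    by (intro tendsto_intros filterlim_ident)
  then show "(uminus \<longlongrightarrow> - a) (nhds a)"
    unfolding uminus_prod_def by simp
qed

instance prod :: (topological_ab_group_add, topological_ab_group_add) topological_ab_group_add ..

instance prod :: (lcag, lcag) lcag
proof
  fix x :: "'a \<times> 'b"
  obtain U K where UK: "open U" "compact K" "fst x \<in> U" "U \<subseteq> K"
    using locally_compact by blast
  obtain V M where VM: "open V" "compact M" "snd x \<in> V" "V \<subseteq> M"
    using locally_compact by blast
  have "open (U \<times> V) \<and> compact (K \<times> M) \<and> x \<in> U \<times> V \<and> U \<times> V \<subseteq> K \<times> M"
    using UK VM by (auto simp: open_Times compact_Times mem_Times_iff)
  then show "\<exists>U K. open U \<and> compact K \<and> x \<in> U \<and> U \<subseteq> K" by blast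
qed

definition sigma_compact :: "'a::topological_space set \<Rightarrow> bool" where
  "sigma_compact S \<longleftrightarrow> (\<exists>K :: nat \<Rightarrow> 'a set. (\<forall>n. compact (K n)) \<and> S = (\<Union>n. K n))"

definition add_subgroup :: "'a::group_add set \<Rightarrow> bool" where
  "add_subgroup S \<longleftrightarrow> 0 \<in> S \<and> (\<forall>x\<in>S. \<forall>y\<in>S. x + y \<in> S) \<and> (\<forall>x\<in>S. - x \<in> S)"

definition coset :: "'a::group_add set \<Rightarrow> 'a \<Rightarrow> 'a set" where
  "coset S x = (\<lambda>s. x + s) ` S"

definition quotient_topology :: "'a::{topological_space, group_add} set \<Rightarrow> 'a set topology" where
  "quotient_topology S = topology (\<lambda>V. V \<subseteq> range (coset S) \<and> open {x. coset S x \<in> V})"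

lemma openin_quotient_topology:
  "openin (quotient_topology S) V \<longleftrightarrow> V \<subseteq> range (coset S) \<and> open {x. coset S x \<in> V}"
proof -
  have "istopology (\<lambda>V. V \<subseteq> range (coset S) \<and> open {x. coset S x \<in> V})"
    unfolding istopology_def
  proof (intro conjI allI impI)
    fix V W
    assume "V \<subseteq> range (coset S) \<and> open {x. coset S x \<in> V}"
       and "W \<subseteq> range (coset S) \<and> open {x. coset S x \<in> W}"
    then show "V \<inter> W \<subseteq> range (coset S)" "open {x. coset S x \<in> V \<inter> W}"
      by (auto simp: Collect_conj_eq)
  next
    fix \<K>
    assume *: "\<forall>K\<in>\<K>. K \<subseteq> range (coset S) \<and> open {x. coset S x \<in> K}"
    then show "\<Union>\<K> \<subseteq> range (coset S)" by blast
    have "{x. coset S x \<in> \<Union>\<K>} = (\<Union>K\<in>\<K>. {x. coset S x \<in> K})" by auto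
    then show "open {x. coset S x \<in> \<Union>\<K>}" using * by auto
  qed
  then show ?thesis
    unfolding quotient_topology_def by (simp add: topology_inverse')
qed

lemma topspace_quotient_topology: "topspace (quotient_topology S) = range (coset S)"
proof -
  have "openin (quotient_topology S) (range (coset S))"
    by (simp add: openin_quotient_topology)
  then show ?thesis
    using openin_subset openin_topspace openin_quotient_topology by (metis subset_antisym)
qed

definition lattice_subgroup :: "'a::lcag set \<Rightarrow> bool" where
  "lattice_subgroup S \<longleftrightarrow> add_subgroup S \<and> discrete S \<and> compact_space (quotient_topology S)"


section \<open>Cut and project schemes\<close>

text \<open>The groups \<open>G\<close> and \<open>H\<close> are the types of the two components.\<close>

definition cut_and_project_scheme :: "('g::lcag \<times> 'h::lcag) set \<Rightarrow> bool" where
  "cut_and_project_scheme \<L> \<longleftrightarrow>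
     sigma_compact (UNIV :: 'g set) \<and>
     lattice_subgroup \<L> \<and>
     closure (snd ` \<L>) = UNIV \<and>
     inj_on fst \<L>"

definition star_map :: "('g \<times> 'h) set \<Rightarrow> 'g \<Rightarrow> 'h" where
  "star_map \<L> x = snd (the_inv_into \<L> fst x)"

definition model_set :: "('g \<times> 'h) set \<Rightarrow> 'h set \<Rightarrow> 'g set" where
  "model_set \<L> W = {x \<in> fst ` \<L>. star_map \<L> x \<in> W}"


section \<open>Complex Radon measures\<close>

definition Cc :: "('a::topological_space \<Rightarrow> complex) set" where
  "Cc = {\<phi>. continuous_on UNIV \<phi> \<and> compact (closure {x. \<phi> x \<noteq> 0})}"

text \<open>
  A measure is a linear functional on \<open>Cc\<close>.  It is represented by a function defined on all
  functions \<open>'a \<Rightarrow> complex\<close>, of which only the values on \<open>Cc\<close> are relevant.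
\<close>

definition radon_measure :: "(('a::topological_space \<Rightarrow> complex) \<Rightarrow> complex) \<Rightarrow> bool" where
  "radon_measure \<mu> \<longleftrightarrow>
     (\<forall>\<phi>\<in>Cc. \<forall>\<psi>\<in>Cc. \<mu> (\<lambda>x. \<phi> x + \<psi> x) = \<mu> \<phi> + \<mu> \<psi>) \<and>
     (\<forall>c. \<forall>\<phi>\<in>Cc. \<mu> (\<lambda>x. c * \<phi> x) = c * \<mu> \<phi>) \<and>
     (\<forall>K. compact K \<longrightarrow>
        (\<exists>C::real. \<forall>\<phi>\<in>Cc. closure {x. \<phi> x \<noteq> 0} \<subseteq> K \<longrightarrow> cmod (\<mu> \<phi>) \<le> C * (SUP x. cmod (\<phi> x))))"

definition dirac :: "'a \<Rightarrow> ('a \<Rightarrow> complex) \<Rightarrow> complex" where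
  "dirac x \<phi> = \<phi> x"

text \<open>
  The formal sum of \<open>w x\<close> times the unit mass at \<open>x\<close>, over \<open>x\<close> in \<open>S\<close>.  If every compact set
  contains only finitely many points of \<open>S\<close>, as for weak model sets and for lattices, the sum
  has only finitely many nonzero terms for each \<open>\<phi>\<close> in \<open>Cc\<close>.
\<close>

definition dirac_comb :: "'a set \<Rightarrow> ('a \<Rightarrow> complex) \<Rightarrow> ('a \<Rightarrow> complex) \<Rightarrow> complex" where
  "dirac_comb S w \<phi> = (\<Sum>\<^sub>\<infinity>x\<in>S. w x * dirac x \<phi>)"


section \<open>Haar measure, convolution and positive definiteness\<close>

text \<open>
  Haar measure is taken in the same sense as all other measures, as a functional on \<open>Cc\<close>; this
  avoids the Borel \<open>\<sigma>\<close>-algebra of groups that are not second countable.  It is unique only up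
  to a positive factor, so the notions below have it as a parameter.
\<close>

definition haar_measure :: "(('a::lcag \<Rightarrow> complex) \<Rightarrow> complex) \<Rightarrow> bool" where
  "haar_measure \<theta> \<longleftrightarrow>
     radon_measure \<theta> \<and>
     (\<forall>\<phi>\<in>Cc. (\<forall>x. \<phi> x \<in> \<real>\<^sub>\<ge>\<^sub>0) \<longrightarrow> \<theta> \<phi> \<in> \<real>\<^sub>\<ge>\<^sub>0) \<and>
     (\<forall>t. \<forall>\<phi>\<in>Cc. \<theta> (\<lambda>x. \<phi> (t + x)) = \<theta> \<phi>) \<and>
     (\<exists>\<phi>\<in>Cc. \<theta> \<phi> \<noteq> 0)"

definition convolution ::
    "(('a::lcag \<Rightarrow> complex) \<Rightarrow> complex) \<Rightarrow> ('a \<Rightarrow> complex) \<Rightarrow> ('a \<Rightarrow> complex) \<Rightarrow> 'a \<Rightarrow> complex" where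
  "convolution \<theta> \<phi> \<psi> x = \<theta> (\<lambda>y. \<phi> y * \<psi> (x - y))"

definition reflected_conj :: "('a::lcag \<Rightarrow> complex) \<Rightarrow> 'a \<Rightarrow> complex" where
  "reflected_conj \<phi> x = cnj (\<phi> (- x))"

definition positive_definite_measure ::
    "(('a::lcag \<Rightarrow> complex) \<Rightarrow> complex) \<Rightarrow> (('a \<Rightarrow> complex) \<Rightarrow> complex) \<Rightarrow> bool" where
  "positive_definite_measure \<theta> \<mu> \<longleftrightarrow>
     radon_measure \<mu> \<and>
     (\<forall>\<phi>\<in>Cc. \<mu> (convolution \<theta> \<phi> (reflected_conj \<phi>)) \<in> \<real>\<^sub>\<ge>\<^sub>0)"

end

theory Submission
  imports Defs "HOL-Real_Asymp.Real_Asymp"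
begin

text \<open>
  Both conditions are equivalent to positive definiteness of the coefficient function \<open>f\<close> on
  the discrete group \<open>L \<cong> \<L>\<close>.  A locally finite comb that is positive definite, tested on
  sums of translates of a narrow bump function, yields the quadratic sums of its coefficients.
  Conversely, if the coefficients \<open>w\<close> are positive definite, then so is the finitely supported
  function \<open>w \<cdot> (\<phi> * \<phi>~)\<close>, and averaging its quadratic sums over a Foelner sequence of
  the discrete group shows that the sum of its values, which is the comb evaluated at
  \<open>\<phi> * \<phi>~\<close>, is nonnegative.
\<close>

section \<open>Foelner sets in Abelian groups\<close>

lemma add_subgroup_diff:
  assumes "add_subgroup M" "x \<in> M" "y \<in> M"
  shows "x - y \<in> M"
  using assms unfolding add_subgroup_def diff_conv_add_uminus by blast

lemma add_subgroup_sum: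
  fixes M :: "'a::ab_group_add set"
  assumes "add_subgroup M" "\<And>i. i \<in> I \<Longrightarrow> h i \<in> M"
  shows "sum h I \<in> M"
  using assms(2)
proof (induction I rule: infinite_finite_induct)
  case (insert i I)
  then show ?case
    using assms(1) unfolding add_subgroup_def by simp
qed (use assms(1) in \<open>auto simp: add_subgroup_def\<close>)

text \<open>Only the finitely many translations by elements of \<open>A\<close> matter, and in a
  commutative group the words in these elements grow polynomially. The bound counts the points that
  a translation keeps inside \<open>F\<close>, since these counts are the weights that appear in
  \<open>sum_differences_eq\<close>.\<close>

lemma ex_Foelner_set:
  fixes M :: "'a::ab_group_add set" and \<epsilon> :: real
  assumes M: "add_subgroup M" and A: "finite A" "A \<subseteq> M" and "\<epsilon> > 0"
  obtains F where "finite F" "F \<noteq> {}" "F \<subseteq> M"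
    "\<And>x. x \<in> A \<Longrightarrow> (1 - \<epsilon>) * card F \<le> card {t \<in> F. x + t \<in> F}"
proof -
  \<comment> \<open>The sets \<open>F n\<close> grow polynomially, so \<open>card (F (Suc n)) / card (F n)\<close> comes arbitrarily close to 1.\<close>
  define comb where "comb k = (\<Sum>a\<in>A. \<Sum>i<k a. a)" for k :: "'a \<Rightarrow> nat"
  define F where "F n = comb ` (A \<rightarrow>\<^sub>E {..n})" for n :: nat
  have fin: "finite (F n)" for n
    unfolding F_def by (intro finite_imageI finite_PiE A) auto
  have sub: "F n \<subseteq> M" for n
    unfolding F_def comb_def using A by (auto intro!: add_subgroup_sum[OF M])
  have ne: "F n \<noteq> {}" for n
    unfolding F_def by (auto simp: PiE_eq_empty_iff)
  have mono: "F n \<subseteq> F (Suc n)" for n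
    unfolding F_def by (intro image_mono PiE_mono) auto
  \<comment> \<open>\<open>comb k\<close> is the combination of \<open>A\<close> with multiplicities
    \<open>k a\<close>. Adding \<open>x\<close> raises the multiplicity of \<open>x\<close> by one,
    so the bound on the multiplicities grows by at most one.\<close>
  have shift: "x + t \<in> F (Suc n)" if x: "x \<in> A" and t: "t \<in> F n" for x t n
  proof -
    obtain k where k: "k \<in> A \<rightarrow>\<^sub>E {..n}" "t = comb k"
      using t unfolding F_def by auto
    have "comb (k(x := Suc (k x))) = (\<Sum>i<Suc (k x). x) + (\<Sum>a\<in>A - {x}. \<Sum>i<k a. a)"
      unfolding comb_def sum.remove[OF A(1) x] by (auto intro!: sum.cong)
    also have "\<dots> = x + comb k"
      unfolding comb_def sum.remove[OF A(1) x] sum.lessThan_Suc by (simp only: ac_simps)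
    finally have "x + t = comb (k(x := Suc (k x)))"
      using k by simp
    moreover have "k(x := Suc (k x)) \<in> A \<rightarrow>\<^sub>E {..Suc n}"
      using k(1) x by (auto simp: PiE_iff extensional_def le_SucI)
    ultimately show ?thesis
      unfolding F_def by blast
  qed
  have growth: "card (F n) \<le> (n + 1) ^ card A" for n
  proof -
    have "card (F n) \<le> card (A \<rightarrow>\<^sub>E {..n})"
      unfolding F_def by (intro card_image_le finite_PiE A) auto
    then show ?thesis
      using A by (simp add: card_PiE)
  qed
  have "\<exists>n. card (F (Suc n)) \<le> (1 + \<epsilon>) * card (F n)"
  proof (rule ccontr)
    assume *: "\<not> ?thesis"
    have "(1 + \<epsilon>) ^ n \<le> card (F n)" for n
    proof (induction n)
      case 0
      then show ?case
        using ne[of 0] fin[of 0] by (simp add: card_gt_0_iff Suc_le_eq)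
    next
      case (Suc n)
      have "(1 + \<epsilon>) ^ Suc n \<le> (1 + \<epsilon>) * card (F n)"
        using Suc \<open>\<epsilon> > 0\<close> by simp
      also have "\<dots> \<le> card (F (Suc n))"
        using * by (meson linorder_not_le less_imp_le)
      finally show ?case .
    qed
    moreover have "eventually (\<lambda>n. (real n + 1) ^ card A < (1 + \<epsilon>) ^ n) sequentially"
      using \<open>\<epsilon> > 0\<close> by real_asymp
    then obtain n where "(real n + 1) ^ card A < (1 + \<epsilon>) ^ n"
      using eventually_sequentially by auto
    moreover have "real (card (F n)) \<le> (real n + 1) ^ card A"
      using growth[of n] by (metis of_nat_1 of_nat_add of_nat_mono of_nat_power)
    ultimately show False
      by (smt (verit))
  qed
  then obtain n where n: "card (F (Suc n)) \<le> (1 + \<epsilon>) * card (F n)"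
    by blast
  have "(1 - \<epsilon>) * card (F n) \<le> card {t \<in> F n. x + t \<in> F n}" if "x \<in> A" for x
  proof -
    \<comment> \<open>A point pushed out of \<open>F n\<close> by \<open>x\<close> lands in
      \<open>F (Suc n) - F n\<close>, and translation is injective. Hence at most the fraction
      \<epsilon> of the points is lost.\<close>
    have "card {t \<in> F n. x + t \<notin> F n} \<le> card (F (Suc n) - F n)"
      using shift[OF that] fin by (intro card_inj_on_le[of "(+) x"]) auto
    also have "\<dots> = card (F (Suc n)) - card (F n)"
      using mono fin by (intro card_Diff_subset)
    finally have "real (card {t \<in> F n. x + t \<notin> F n}) \<le> real (card (F (Suc n))) - real (card (F n))"
      using card_mono[OF fin mono[of n]] by linarith
    moreover have "card (F n) = card {t \<in> F n. x + t \<in> F n} + card {t \<in> F n. x + t \<notin> F n}"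
      using fin by (subst card_Un_disjoint[symmetric]) (auto intro: arg_cong[where f = card])
    ultimately show ?thesis
      using n by (simp add: algebra_simps)
  qed
  then show thesis
    by (rule that[OF fin ne sub])
qed

text \<open>Group the pairs by their difference \<open>x\<close>: the pairs in \<open>F\<close> with
  \<open>s - t = x\<close> correspond to those \<open>t\<close> in \<open>F\<close> with
  \<open>x + t\<close> in \<open>F\<close>.\<close>

lemma sum_differences_eq:
  fixes p :: "'a::ab_group_add \<Rightarrow> complex"
  assumes "finite F" "finite D" "\<And>x. x \<notin> D \<Longrightarrow> p x = 0"
  shows "(\<Sum>s\<in>F. \<Sum>t\<in>F. p (s - t)) = (\<Sum>x\<in>D. p x * card {t \<in> F. x + t \<in> F})"
proof -
  have *: "(\<Sum>s\<in>F. p (s - t)) = (\<Sum>x\<in>D. if x + t \<in> F then p x else 0)" for t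
  proof -
    have "(\<Sum>s\<in>F. p (s - t)) = (\<Sum>s\<in>{s \<in> F. s - t \<in> D}. p (s - t))"
      using assms by (intro sum.mono_neutral_right) auto
    also have "\<dots> = (\<Sum>x\<in>{x \<in> D. x + t \<in> F}. p x)"
      by (rule sum.reindex_bij_witness[of _ "\<lambda>x. x + t" "\<lambda>s. s - t"]) auto
    also have "\<dots> = (\<Sum>x\<in>D. if x + t \<in> F then p x else 0)"
      using assms by (simp add: sum.inter_filter)
    finally show ?thesis .
  qed
  have "(\<Sum>s\<in>F. \<Sum>t\<in>F. p (s - t)) = (\<Sum>t\<in>F. \<Sum>s\<in>F. p (s - t))"
    by (rule sum.swap)
  also have "\<dots> = (\<Sum>x\<in>D. \<Sum>t\<in>F. if x + t \<in> F then p x else 0)"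
    unfolding * by (rule sum.swap)
  also have "\<dots> = (\<Sum>x\<in>D. p x * card {t \<in> F. x + t \<in> F})"
    using assms by (simp add: sum.inter_filter[symmetric] mult.commute)
  finally show ?thesis .
qed

text \<open>Divided by \<open>card F\<close>, the double sum is the sum of \<open>p\<close> with
  each \<open>p x\<close> weighted by the proportion of \<open>F\<close> that translation by
  \<open>x\<close> keeps in \<open>F\<close>. Along Foelner sets these weights tend to 1, and the
  nonnegative reals are closed.\<close>

lemma nonneg_sum_of_sum_differences:
  fixes p :: "'a::ab_group_add \<Rightarrow> complex"
  assumes M: "add_subgroup M" and D: "finite D" "D \<subseteq> M" "\<And>x. x \<notin> D \<Longrightarrow> p x = 0"
    and nonneg: "\<And>F. finite F \<Longrightarrow> F \<subseteq> M \<Longrightarrow> (\<Sum>s\<in>F. \<Sum>t\<in>F. p (s - t)) \<in> \<real>\<^sub>\<ge>\<^sub>0"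
  shows "(\<Sum>x\<in>D. p x) \<in> \<real>\<^sub>\<ge>\<^sub>0"
proof -
  define good where "good n F \<longleftrightarrow> finite F \<and> F \<noteq> {} \<and> F \<subseteq> M \<and>
    (\<forall>x\<in>D. (1 - inverse (real (Suc n))) * card F \<le> card {t \<in> F. x + t \<in> F})" for n F
  have "\<exists>F. good n F" for n
  proof -
    have "inverse (real (Suc n)) > 0"
      by simp
    then obtain F where "finite F" "F \<noteq> {}" "F \<subseteq> M"
      "\<And>x. x \<in> D \<Longrightarrow> (1 - inverse (real (Suc n))) * card F \<le> card {t \<in> F. x + t \<in> F}"
      using ex_Foelner_set[OF M D(1,2)] by blast
    then show ?thesis
      unfolding good_def by blast
  qed
  then obtain F where F: "\<And>n. good n (F n)"
    by metis
  define r where "r x n = card {t \<in> F n. x + t \<in> F n} / card (F n)" for x n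
  have card_pos: "real (card (F n)) > 0" for n
    using F[of n] unfolding good_def by (simp add: card_gt_0_iff)
  have lim: "r x \<longlonglongrightarrow> 1" if "x \<in> D" for x
  proof (rule tendsto_sandwich)
    show "(\<lambda>n. 1 - inverse (real (Suc n))) \<longlonglongrightarrow> 1"
      by real_asymp
    show "eventually (\<lambda>n. 1 - inverse (real (Suc n)) \<le> r x n) sequentially"
      using F that card_pos unfolding r_def good_def by (simp add: pos_le_divide_eq)
    have "card {t \<in> F n. x + t \<in> F n} \<le> card (F n)" for n
      using F[of n] unfolding good_def by (intro card_mono) auto
    then show "eventually (\<lambda>n. r x n \<le> 1) sequentially"
      using card_pos unfolding r_def by (simp add: pos_divide_le_eq)
  qed simp
  have "(\<lambda>n. \<Sum>x\<in>D. p x * of_real (r x n)) \<longlonglongrightarrow> (\<Sum>x\<in>D. p x * of_real 1)"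
    by (intro tendsto_sum tendsto_mult tendsto_const tendsto_of_real lim)
  moreover have "(\<Sum>x\<in>D. p x * of_real (r x n)) \<in> \<real>\<^sub>\<ge>\<^sub>0" for n
  proof -
    have "(\<Sum>x\<in>D. p x * of_real (r x n)) =
      (\<Sum>s\<in>F n. \<Sum>t\<in>F n. p (s - t)) * of_real (inverse (card (F n)))"
      using F[of n] D unfolding good_def r_def
      by (subst sum_differences_eq[where D = D]) (auto simp: sum_distrib_right divide_inverse mult.assoc)
    moreover have "(\<Sum>s\<in>F n. \<Sum>t\<in>F n. p (s - t)) \<in> \<real>\<^sub>\<ge>\<^sub>0"
      using nonneg F[of n] unfolding good_def by blast
    ultimately show ?thesis
      by (simp add: nonneg_Reals_mult_I)
  qed
  ultimately show ?thesis
    using closed_sequentially[OF closed_nonneg_Reals_complex,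
        of "\<lambda>n. \<Sum>x\<in>D. p x * of_real (r x n)" "\<Sum>x\<in>D. p x"] by simp
qed


section \<open>Haar functionals and Dirac combs\<close>

lemma Cc_I:
  fixes \<phi> :: "'a::t2_space \<Rightarrow> complex"
  assumes "continuous_on UNIV \<phi>" "compact K" "\<And>x. x \<notin> K \<Longrightarrow> \<phi> x = 0"
  shows "\<phi> \<in> Cc"
proof -
  have "closure {x. \<phi> x \<noteq> 0} \<subseteq> K"
    using assms by (intro closure_minimal compact_imp_closed) auto
  then have "compact (closure {x. \<phi> x \<noteq> 0})"
    using compact_Int_closed[OF assms(2) closed_closure] by (metis inf.absorb2)
  with assms(1) show ?thesis
    unfolding Cc_def by simp
qed

lemma Cc_E:
  assumes "\<phi> \<in> Cc"
  obtains K where "continuous_on UNIV \<phi>" "compact K" "\<And>x. x \<notin> K \<Longrightarrow> \<phi> x = 0"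
proof (rule that)
  show "continuous_on UNIV \<phi>" "compact (closure {x. \<phi> x \<noteq> 0})"
    using assms unfolding Cc_def by auto
  show "\<phi> x = 0" if "x \<notin> closure {x. \<phi> x \<noteq> 0}" for x
    using that closure_subset[of "{x. \<phi> x \<noteq> 0}"] by blast
qed

lemma Cc_bounded:
  assumes "\<phi> \<in> Cc"
  obtains B where "B \<ge> 0" "\<And>x. cmod (\<phi> x) \<le> B"
proof -
  obtain K where K: "continuous_on UNIV \<phi>" "compact K" "\<And>x. x \<notin> K \<Longrightarrow> \<phi> x = 0"
    using Cc_E[OF assms] by blast
  have "compact (\<phi> ` K)"
    using K by (blast intro: compact_continuous_image continuous_on_subset)
  then obtain B where "\<And>x. x \<in> K \<Longrightarrow> cmod (\<phi> x) \<le> B"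
    using compact_imp_bounded bounded_iff by (metis imageI)
  then have "cmod (\<phi> x) \<le> max B 0" for x
    using K(3) by (cases "x \<in> K") (auto simp: le_max_iff_disj)
  with that[of "max B 0"] show thesis
    by simp
qed

lemma Cc_mult_left:
  fixes \<phi> :: "'a::t2_space \<Rightarrow> complex"
  assumes "\<phi> \<in> Cc" "continuous_on UNIV g"
  shows "(\<lambda>x. \<phi> x * g x) \<in> Cc"
proof -
  obtain K where K: "continuous_on UNIV \<phi>" "compact K" "\<And>x. x \<notin> K \<Longrightarrow> \<phi> x = 0"
    using Cc_E[OF assms(1)] by blast
  then show ?thesis
    using assms by (intro Cc_I[of _ K] continuous_intros) auto
qed

lemma Cc_continuous: "\<phi> \<in> Cc \<Longrightarrow> continuous_on UNIV \<phi>"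
  by (simp add: Cc_def)

lemma Cc_cmult:
  fixes \<phi> :: "'a::t2_space \<Rightarrow> complex"
  shows "\<phi> \<in> Cc \<Longrightarrow> (\<lambda>x. c * \<phi> x) \<in> Cc"
  using Cc_mult_left[of \<phi> "\<lambda>_. c"] by (simp add: mult.commute)

lemma Cc_of_continuous_comp:
  fixes \<phi> :: "'a::t2_space \<Rightarrow> complex"
  assumes "\<phi> \<in> Cc" "continuous_on UNIV g" "g 0 = 0"
  shows "(\<lambda>x. g (\<phi> x)) \<in> Cc"
proof -
  obtain K where K: "continuous_on UNIV \<phi>" "compact K" "\<And>x. x \<notin> K \<Longrightarrow> \<phi> x = 0"
    using Cc_E[OF assms(1)] by blast
  then show ?thesis
    using assms by (intro Cc_I[of _ K] continuous_on_compose2[OF assms(2)]) auto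
qed

lemma Cc_add:
  fixes \<phi> :: "'a::t2_space \<Rightarrow> complex"
  assumes "\<phi> \<in> Cc" "\<psi> \<in> Cc"
  shows "(\<lambda>x. \<phi> x + \<psi> x) \<in> Cc"
proof -
  obtain K where K: "continuous_on UNIV \<phi>" "compact K" "\<And>x. x \<notin> K \<Longrightarrow> \<phi> x = 0"
    using Cc_E[OF assms(1)] by blast
  obtain N where N: "continuous_on UNIV \<psi>" "compact N" "\<And>x. x \<notin> N \<Longrightarrow> \<psi> x = 0"
    using Cc_E[OF assms(2)] by blast
  show ?thesis
    using K N by (intro Cc_I[of _ "K \<union> N"] continuous_intros compact_Un) auto
qed

lemma Cc_zero: "(\<lambda>x. 0) \<in> (Cc :: ('a::t2_space \<Rightarrow> complex) set)"
  by (rule Cc_I[of _ "{}"]) auto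

lemma Cc_sum:
  fixes h :: "'i \<Rightarrow> 'a::t2_space \<Rightarrow> complex"
  assumes "\<And>i. i \<in> I \<Longrightarrow> h i \<in> Cc"
  shows "(\<lambda>x. \<Sum>i\<in>I. h i x) \<in> Cc"
  using assms by (induction I rule: infinite_finite_induct) (auto intro: Cc_zero Cc_add)

lemma Cc_translate:
  fixes \<phi> :: "'a::lcag \<Rightarrow> complex"
  assumes "\<phi> \<in> Cc"
  shows "(\<lambda>x. \<phi> (t + x)) \<in> Cc"
proof -
  obtain K where K: "continuous_on UNIV \<phi>" "compact K" "\<And>x. x \<notin> K \<Longrightarrow> \<phi> x = 0"
    using Cc_E[OF assms(1)] by blast
  show ?thesis
  proof (rule Cc_I)
    show "continuous_on UNIV (\<lambda>x. \<phi> (t + x))"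
      by (intro continuous_on_compose2[OF K(1)] continuous_intros) auto
    show "compact ((\<lambda>x. - t + x) ` K)"
      by (intro compact_continuous_image continuous_intros K)
    show "\<phi> (t + x) = 0" if "x \<notin> (\<lambda>x. - t + x) ` K" for x
      using that K(3) by (metis minus_add_cancel image_eqI)
  qed
qed

lemma radon_measure_add:
  "radon_measure \<mu> \<Longrightarrow> \<phi> \<in> Cc \<Longrightarrow> \<psi> \<in> Cc \<Longrightarrow> \<mu> (\<lambda>x. \<phi> x + \<psi> x) = \<mu> \<phi> + \<mu> \<psi>"
  unfolding radon_measure_def by simp

lemma radon_measure_cmult:
  "radon_measure \<mu> \<Longrightarrow> \<phi> \<in> Cc \<Longrightarrow> \<mu> (\<lambda>x. c * \<phi> x) = c * \<mu> \<phi>"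
  unfolding radon_measure_def by simp

lemma radon_measure_zero:
  fixes \<mu> :: "('a::t2_space \<Rightarrow> complex) \<Rightarrow> complex"
  assumes "radon_measure \<mu>"
  shows "\<mu> (\<lambda>x. 0) = 0"
  using radon_measure_cmult[OF assms Cc_zero, of 0] by simp

lemma radon_measure_sum:
  fixes \<theta> :: "('a::t2_space \<Rightarrow> complex) \<Rightarrow> complex"
  assumes "radon_measure \<theta>" "\<And>i. i \<in> I \<Longrightarrow> h i \<in> Cc"
  shows "\<theta> (\<lambda>x. \<Sum>i\<in>I. h i x) = (\<Sum>i\<in>I. \<theta> (h i))"
  using assms(2)
  by (induction I rule: infinite_finite_induct)
    (auto simp: radon_measure_zero[OF assms(1)] radon_measure_add[OF assms(1)] Cc_sum)

section \<open>Dirac combs with locally finite support\<close>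

lemma dirac_comb_eq_sum:
  assumes "finite T" "T \<subseteq> S" "\<And>x. x \<in> S - T \<Longrightarrow> \<phi> x = 0"
  shows "dirac_comb S w \<phi> = (\<Sum>x\<in>T. w x * \<phi> x)"
proof -
  have "dirac_comb S w \<phi> = (\<Sum>\<^sub>\<infinity>x\<in>T. w x * \<phi> x)"
    unfolding dirac_comb_def dirac_def using assms by (intro infsum_cong_neutral) auto
  then show ?thesis
    using assms by simp
qed

lemma radon_measure_dirac_comb:
  fixes S :: "'a::t2_space set"
  assumes fin: "\<And>K. compact K \<Longrightarrow> finite (S \<inter> K)"
  shows "radon_measure (dirac_comb S w)"
  unfolding radon_measure_def
proof (intro conjI ballI allI impI)
  fix \<phi> \<psi> :: "'a \<Rightarrow> complex"
  assume "\<phi> \<in> Cc" "\<psi> \<in> Cc"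
  then obtain K N where K: "compact K" "\<And>x. x \<notin> K \<Longrightarrow> \<phi> x = 0"
    and N: "compact N" "\<And>x. x \<notin> N \<Longrightarrow> \<psi> x = 0"
    by (metis Cc_E)
  have T: "finite (S \<inter> (K \<union> N))"
    using fin K N compact_Un by blast
  \<comment> \<open>One finite index set serves both functions and their sum, so additivity becomes
    additivity of finite sums.\<close>
  have "dirac_comb S w h = (\<Sum>x\<in>S \<inter> (K \<union> N). w x * h x)"
    if "\<And>x. x \<notin> K \<union> N \<Longrightarrow> h x = 0" for h
    using that by (intro dirac_comb_eq_sum T) auto
  then show "dirac_comb S w (\<lambda>x. \<phi> x + \<psi> x) = dirac_comb S w \<phi> + dirac_comb S w \<psi>"
    using K(2) N(2) by (simp add: ring_distribs sum.distrib)
next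
  fix c and \<phi> :: "'a \<Rightarrow> complex"
  assume "\<phi> \<in> Cc"
  then obtain K where K: "compact K" "\<And>x. x \<notin> K \<Longrightarrow> \<phi> x = 0"
    by (metis Cc_E)
  have T: "finite (S \<inter> K)"
    using fin K by blast
  have "dirac_comb S w h = (\<Sum>x\<in>S \<inter> K. w x * h x)" if "\<And>x. x \<notin> K \<Longrightarrow> h x = 0" for h
    using that by (intro dirac_comb_eq_sum T) auto
  then show "dirac_comb S w (\<lambda>x. c * \<phi> x) = c * dirac_comb S w \<phi>"
    using K(2) by (simp add: sum_distrib_left mult.left_commute)
next
  fix K :: "'a set"
  assume K: "compact K"
  \<comment> \<open>The constant is the total variation of the comb on \<open>K\<close>.\<close>
  have "cmod (dirac_comb S w \<phi>) \<le> (\<Sum>x\<in>S \<inter> K. cmod (w x)) * (SUP x. cmod (\<phi> x))"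
    if \<phi>: "\<phi> \<in> Cc" "closure {x. \<phi> x \<noteq> 0} \<subseteq> K" for \<phi>
  proof -
    have "x \<in> K" if "\<phi> x \<noteq> 0" for x
      using that \<phi>(2) closure_subset[of "{x. \<phi> x \<noteq> 0}"] by blast
    then have "dirac_comb S w \<phi> = (\<Sum>x\<in>S \<inter> K. w x * \<phi> x)"
      using fin K by (intro dirac_comb_eq_sum) auto
    then have "cmod (dirac_comb S w \<phi>) \<le> (\<Sum>x\<in>S \<inter> K. cmod (w x) * cmod (\<phi> x))"
      using norm_sum[of "\<lambda>x. w x * \<phi> x" "S \<inter> K"] by (simp add: norm_mult)
    also have "\<dots> \<le> (\<Sum>x\<in>S \<inter> K. cmod (w x) * (SUP x. cmod (\<phi> x)))"
    proof (intro sum_mono mult_left_mono)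
      \<comment> \<open>The supremum is an upper bound only once the values are known to be
        bounded.\<close>
      obtain B where "\<And>x. cmod (\<phi> x) \<le> B"
        using Cc_bounded[OF \<phi>(1)] by blast
      then have "bdd_above (range (\<lambda>x. cmod (\<phi> x)))"
        by (rule bdd_aboveI2)
      then show "cmod (\<phi> x) \<le> (SUP x. cmod (\<phi> x))" for x
        by (rule cSUP_upper[OF UNIV_I])
    qed simp
    finally show ?thesis
      by (simp add: sum_distrib_right)
  qed
  then show "\<exists>C::real. \<forall>\<phi>\<in>Cc. closure {x. \<phi> x \<noteq> 0} \<subseteq> K \<longrightarrow>
      cmod (dirac_comb S w \<phi>) \<le> C * (SUP x. cmod (\<phi> x))"
    by blast
qed

text \<open>A locally compact Hausdorff space is completely regular, so 0 can be separated from the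
  complement of \<open>U \<inter> V\<close>. Shrinking \<open>U\<close> by a set \<open>V\<close>
  inside a compact set makes the support compact.\<close>

lemma ex_bump_function:
  fixes U :: "'a::lcag set"
  assumes "open U" "0 \<in> U"
  obtains g :: "'a \<Rightarrow> real" where "continuous_on UNIV g" "\<And>x. g x \<ge> 0" "g 0 = 1"
    "\<And>x. x \<notin> U \<Longrightarrow> g x = 0" "(\<lambda>x. of_real (g x)) \<in> Cc"
proof -
  obtain V K :: "'a set" where VK: "open V" "compact K" "0 \<in> V" "V \<subseteq> K"
    using locally_compact by blast
  have "Hausdorff_space (euclidean :: 'a topology)"
    unfolding Hausdorff_space_def disjnt_def using hausdorff by (simp, blast)
  then have "completely_regular_space (euclidean :: 'a topology)"
    using locally_compact_space_lcag
    by (intro locally_compact_regular_imp_completely_regular_space disjI1) auto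
  moreover have "closedin euclidean (- (U \<inter> V))" "0 \<in> topspace euclidean - (- (U \<inter> V))"
    using assms VK by auto
  ultimately obtain f :: "'a \<Rightarrow> real"
    where f: "continuous_map euclidean (top_of_set {0..1}) f" "f 0 = 0" "f ` (- (U \<inter> V)) \<subseteq> {1}"
    unfolding completely_regular_space_def by blast
  define g where "g x = 1 - f x" for x
  have cont: "continuous_on UNIV f" and range: "f x \<in> {0..1}" for x
    using f(1) by (auto simp: continuous_map_in_subtopology)
  have g: "continuous_on UNIV g"
    unfolding g_def by (intro continuous_intros cont)
  have "(\<lambda>x. complex_of_real (g x)) \<in> Cc"
    using VK f(3) by (intro Cc_I[of _ K] continuous_intros g) (auto simp: g_def)
  with g show thesis
    using f range by (intro that[of g]) (auto simp: g_def)
qed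

section \<open>Positivity of Haar functionals\<close>

lemma haar_measure_imp_radon: "haar_measure \<theta> \<Longrightarrow> radon_measure \<theta>"
  unfolding haar_measure_def by (elim conjE)

lemma haar_measure_nonneg:
  assumes "haar_measure \<theta>" "\<phi> \<in> Cc" "\<And>x. \<phi> x \<in> \<real>\<^sub>\<ge>\<^sub>0"
  shows "\<theta> \<phi> \<in> \<real>\<^sub>\<ge>\<^sub>0"
proof -
  have "\<forall>\<phi>\<in>Cc. (\<forall>x. \<phi> x \<in> \<real>\<^sub>\<ge>\<^sub>0) \<longrightarrow> \<theta> \<phi> \<in> \<real>\<^sub>\<ge>\<^sub>0"
    using assms(1) unfolding haar_measure_def by (elim conjE)
  from this[rule_format, OF assms(2,3)] show ?thesis .
qed

lemma haar_measure_translate: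
  assumes "haar_measure \<theta>" "\<phi> \<in> Cc"
  shows "\<theta> (\<lambda>x. \<phi> (t + x)) = \<theta> \<phi>"
proof -
  have "\<forall>t. \<forall>\<phi>\<in>Cc. \<theta> (\<lambda>x. \<phi> (t + x)) = \<theta> \<phi>"
    using assms(1) unfolding haar_measure_def by (elim conjE)
  from this[rule_format, OF assms(2)] show ?thesis .
qed

text \<open>If the integral of \<open>g\<close> vanished, so would that of every finite combination
  of its translates. Such combinations dominate every real function in \<open>Cc\<close>, by
  compactness of its support, so the whole functional would vanish.\<close>

lemma haar_measure_nonzero:
  fixes g :: "'a::lcag \<Rightarrow> real"
  assumes \<theta>: "haar_measure \<theta>" and g: "continuous_on UNIV g" "(\<lambda>x. of_real (g x)) \<in> Cc"
    and nonneg: "\<And>x. g x \<ge> 0" and "g 0 > 0"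
  shows "\<theta> (\<lambda>x. of_real (g x)) \<noteq> 0"
proof
  assume null: "\<theta> (\<lambda>x. of_real (g x)) = 0"
  have real_null: "\<theta> (\<lambda>x. of_real (\<psi> x)) = 0"
    if \<psi>: "(\<lambda>x. of_real (\<psi> x)) \<in> Cc" for \<psi> :: "'a \<Rightarrow> real"
  proof -
    obtain K where "continuous_on UNIV (\<lambda>x. complex_of_real (\<psi> x))"
      and K: "compact K" "\<And>x. x \<notin> K \<Longrightarrow> complex_of_real (\<psi> x) = 0"
      using Cc_E[OF \<psi>] by blast
    obtain B where B: "B \<ge> 0" "\<And>x. cmod (complex_of_real (\<psi> x)) \<le> B"
      using Cc_bounded[OF \<psi>] by blast
    have "open {x. g (- k + x) > g 0 / 2}" for k
      by (intro open_Collect_less continuous_intros continuous_on_compose2[OF g(1)]) auto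
    moreover have "K \<subseteq> (\<Union>k\<in>K. {x. g (- k + x) > g 0 / 2})"
      using \<open>g 0 > 0\<close> by auto
    ultimately obtain I where I: "I \<subseteq> K" "finite I" "K \<subseteq> (\<Union>k\<in>I. {x. g (- k + x) > g 0 / 2})"
      using compactE_image[OF K(1), of K "\<lambda>k. {x. g (- k + x) > g 0 / 2}"] by blast
    \<comment> \<open>Chosen so that \<open>C * (g 0 / 2) = B\<close>: at each point of
      \<open>K\<close> some translate exceeds \<open>g 0 / 2\<close>, hence the combination
      \<open>h\<close> exceeds the bound \<open>B\<close> of \<psi> there.\<close>
    define C where "C = 2 * B / g 0"
    define h where "h x = C * (\<Sum>k\<in>I. g (- k + x))" for x
    have C: "C \<ge> 0"
      using B \<open>g 0 > 0\<close> unfolding C_def by simp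
    have h_nonneg: "h x \<ge> 0" for x
      unfolding h_def using C nonneg by (intro mult_nonneg_nonneg sum_nonneg)
    have dom: "\<bar>\<psi> x\<bar> \<le> h x" for x
    proof (cases "x \<in> K")
      case True
      then obtain k where k: "k \<in> I" "g (- k + x) > g 0 / 2"
        using I by auto
      have "\<bar>\<psi> x\<bar> \<le> C * (g 0 / 2)"
        using B(2)[of x] \<open>g 0 > 0\<close> unfolding C_def by simp
      also have "\<dots> \<le> C * g (- k + x)"
        using C k by (intro mult_left_mono) auto
      also have "\<dots> \<le> h x"
        unfolding h_def using C k I nonneg by (intro mult_left_mono member_le_sum) auto
      finally show ?thesis .
    qed (use K h_nonneg in auto)
    have translates: "(\<lambda>x. complex_of_real (g (- k + x))) \<in> Cc" for k
      using Cc_translate[OF g(2)] .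
    have h_eq: "(\<lambda>x. complex_of_real (h x)) = (\<lambda>x. of_real C * (\<Sum>k\<in>I. of_real (g (- k + x))))"
      unfolding h_def by simp
    have h_Cc: "(\<lambda>x. complex_of_real (h x)) \<in> Cc"
      unfolding h_eq by (intro Cc_cmult Cc_sum translates)
    have "\<theta> (\<lambda>x. of_real (h x)) = of_real C * (\<Sum>k\<in>I. \<theta> (\<lambda>x. of_real (g (- k + x))))"
      unfolding h_eq using translates Cc_sum[of I, OF translates]
      by (simp add: radon_measure_cmult[OF haar_measure_imp_radon[OF \<theta>]] radon_measure_sum[OF haar_measure_imp_radon[OF \<theta>]])
    then have h_null: "\<theta> (\<lambda>x. of_real (h x)) = 0"
      using null by (simp only: haar_measure_translate[OF \<theta> g(2)]) simp
    \<comment> \<open>Both \<open>h + \<psi>\<close> and \<open>h - \<psi>\<close> are nonnegative.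
      As \<open>h\<close> has integral 0, the integral of \<psi> and its negative are both
      nonnegative, which forces 0.\<close>
    have "\<theta> (\<lambda>x. of_real (h x) + c * of_real (\<psi> x)) \<in> \<real>\<^sub>\<ge>\<^sub>0" if "c \<in> {1, - 1}" for c
    proof (rule haar_measure_nonneg[OF \<theta>])
      show "(\<lambda>x. of_real (h x) + c * of_real (\<psi> x)) \<in> Cc"
        by (intro Cc_add Cc_cmult h_Cc \<psi>)
      show "of_real (h x) + c * of_real (\<psi> x) \<in> \<real>\<^sub>\<ge>\<^sub>0" for x
        using dom[of x] that by (auto simp: complex_nonneg_Reals_iff)
    qed
    then have "c * \<theta> (\<lambda>x. of_real (\<psi> x)) \<in> \<real>\<^sub>\<ge>\<^sub>0" if "c \<in> {1, - 1}" for c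
      using that h_null
      by (simp add: radon_measure_add[OF haar_measure_imp_radon[OF \<theta>] h_Cc Cc_cmult[OF \<psi>]] radon_measure_cmult[OF haar_measure_imp_radon[OF \<theta>] \<psi>])
    from this[of 1] this[of "-1"] show ?thesis
      by (auto simp: complex_nonneg_Reals_iff complex_eq_iff)
  qed
  obtain \<phi> where \<phi>: "\<phi> \<in> Cc" "\<theta> \<phi> \<noteq> 0"
    using \<theta> unfolding haar_measure_def by (elim conjE bexE)
  have re: "(\<lambda>x. complex_of_real (Re (\<phi> x))) \<in> Cc"
    and im: "(\<lambda>x. complex_of_real (Im (\<phi> x))) \<in> Cc"
    by (auto intro!: Cc_of_continuous_comp[OF \<phi>(1), of "\<lambda>z. of_real (Re z)"]
        Cc_of_continuous_comp[OF \<phi>(1), of "\<lambda>z. of_real (Im z)"] continuous_intros)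
  have "\<phi> = (\<lambda>x. of_real (Re (\<phi> x)) + \<i> * of_real (Im (\<phi> x)))"
    by (simp add: complex_eq_iff fun_eq_iff)
  then have "\<theta> \<phi> = \<theta> (\<lambda>x. of_real (Re (\<phi> x)) + \<i> * of_real (Im (\<phi> x)))"
    by simp
  also have "\<dots> = 0"
    using real_null[OF re] real_null[OF im]
    by (simp add: radon_measure_add[OF haar_measure_imp_radon[OF \<theta>] re Cc_cmult[OF im]] radon_measure_cmult[OF haar_measure_imp_radon[OF \<theta>] im])
  finally show False
    using \<phi> by simp
qed


section \<open>Positive definite combs\<close>

text \<open>The usual notion for functions on a discrete group; the topology of the ambient group
  does not enter. Summing over a finite set instead of a list of points loses nothing, since the
  coefficients of repeated points can be added up.\<close>

definition positive_definite_on :: "'a::group_add set \<Rightarrow> ('a \<Rightarrow> complex) \<Rightarrow> bool" where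
  "positive_definite_on M w \<longleftrightarrow> (\<forall>F c. finite F \<longrightarrow> F \<subseteq> M \<longrightarrow>
     (\<Sum>s\<in>F. \<Sum>t\<in>F. c s * cnj (c t) * w (s - t)) \<in> \<real>\<^sub>\<ge>\<^sub>0)"

lemma Cc_cnj: "\<phi> \<in> Cc \<Longrightarrow> (\<lambda>x::'a::t2_space. cnj (\<phi> x)) \<in> Cc"
  by (rule Cc_of_continuous_comp) (auto intro: continuous_intros)

text \<open>Substituting \<open>s + y\<close> for \<open>y\<close> by translation invariance
  separates \<open>s\<close> from \<open>t\<close>. In this symmetric form, \<phi> evaluated at
  \<open>s + y\<close> and \<open>t + y\<close> supplies the coefficients of a quadratic
  sum.\<close>

lemma convolution_reflected_conj:
  fixes \<phi> :: "'a::lcag \<Rightarrow> complex"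
  assumes \<theta>: "haar_measure \<theta>" and \<phi>: "\<phi> \<in> Cc"
  shows "convolution \<theta> \<phi> (reflected_conj \<phi>) (s - t) = \<theta> (\<lambda>y. \<phi> (s + y) * cnj (\<phi> (t + y)))"
proof -
  have "(\<lambda>y. \<phi> y * cnj (\<phi> (y - (s - t)))) = (\<lambda>y. \<phi> y * cnj (\<phi> ((t - s) + y)))"
    by (simp add: algebra_simps)
  moreover have "(\<lambda>y. \<phi> y * cnj (\<phi> ((t - s) + y))) \<in> Cc"
    by (intro Cc_mult_left \<phi> Cc_continuous Cc_cnj Cc_translate)
  ultimately have "\<theta> (\<lambda>y. \<phi> y * cnj (\<phi> (y - (s - t)))) = \<theta> (\<lambda>y. \<phi> (s + y) * cnj (\<phi> ((t - s) + (s + y))))"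
    using haar_measure_translate[OF \<theta>, of "\<lambda>y. \<phi> y * cnj (\<phi> ((t - s) + y))" s] by simp
  then show ?thesis
    unfolding convolution_def reflected_conj_def by (simp add: algebra_simps)
qed

text \<open>The integrand is nonzero at \<open>y\<close> only if \<open>y\<close> and
  \<open>y - x\<close> both lie in the compact set carrying \<phi>, so \<open>x\<close> is a
  difference of two of its points. This leaves finitely many terms when a locally finite comb is
  evaluated.\<close>

lemma convolution_compact_support:
  fixes \<phi> :: "'a::lcag \<Rightarrow> complex"
  assumes \<theta>: "haar_measure \<theta>" and \<phi>: "\<phi> \<in> Cc"
  obtains K where "compact K" "\<And>x. x \<notin> K \<Longrightarrow> convolution \<theta> \<phi> (reflected_conj \<phi>) x = 0"
proof -
  obtain K where "continuous_on UNIV \<phi>" and K: "compact K" "\<And>x. x \<notin> K \<Longrightarrow> \<phi> x = 0"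
    using Cc_E[OF \<phi>] by blast
  show thesis
  proof (rule that)
    show "compact ((\<lambda>p. fst p - snd p) ` (K \<times> K))"
      by (intro compact_continuous_image continuous_intros compact_Times K)
    fix x assume x: "x \<notin> (\<lambda>p. fst p - snd p) ` (K \<times> K)"
    have "\<phi> y * cnj (\<phi> (y - x)) = 0" for y
    proof (rule ccontr)
      assume "\<phi> y * cnj (\<phi> (y - x)) \<noteq> 0"
      then have "y \<in> K" "y - x \<in> K"
        using K(2) by auto
      then have "x \<in> (\<lambda>p. fst p - snd p) ` (K \<times> K)"
        by (intro image_eqI[of _ _ "(y, y - x)"]) auto
      with x show False ..
    qed
    then have "(\<lambda>y. \<phi> y * cnj (\<phi> (- (x - y)))) = (\<lambda>y. 0)"
      by (simp add: fun_eq_iff)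
    then show "convolution \<theta> \<phi> (reflected_conj \<phi>) x = 0"
      unfolding convolution_def reflected_conj_def
      using radon_measure_zero[OF haar_measure_imp_radon[OF \<theta>]] by simp
  qed
qed

text \<open>
  The quadratic sums of \<open>w \<cdot> (\<phi> * \<phi>~)\<close> are Haar integrals over \<open>y\<close> of quadratic sums
  of \<open>w\<close> with coefficients \<open>\<phi> (s + y)\<close>.
\<close>

lemma positive_definite_dirac_combI:
  fixes S M :: "'a::lcag set"
  assumes \<theta>: "haar_measure \<theta>"
    and fin: "\<And>K. compact K \<Longrightarrow> finite (S \<inter> K)"
    and M: "add_subgroup M" "S \<subseteq> M"
    and w: "\<And>x. x \<notin> S \<Longrightarrow> w x = 0"
    and pd: "positive_definite_on M w"
  shows "positive_definite_measure \<theta> (dirac_comb S w)"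
  unfolding positive_definite_measure_def
proof (intro conjI ballI)
  show "radon_measure (dirac_comb S w)"
    by (rule radon_measure_dirac_comb[OF fin])
  fix \<phi> :: "'a \<Rightarrow> complex"
  assume \<phi>: "\<phi> \<in> Cc"
  let ?C = "convolution \<theta> \<phi> (reflected_conj \<phi>)"
  obtain K where K: "compact K" "\<And>x. x \<notin> K \<Longrightarrow> ?C x = 0"
    using convolution_compact_support[OF \<theta> \<phi>] by blast
  have "dirac_comb S w ?C = (\<Sum>x\<in>S \<inter> K. w x * ?C x)"
    using K fin by (intro dirac_comb_eq_sum) auto
  also have "\<dots> \<in> \<real>\<^sub>\<ge>\<^sub>0"
  proof (rule nonneg_sum_of_sum_differences[OF M(1) fin[OF K(1)]])
    show "S \<inter> K \<subseteq> M"
      using M by blast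
    show "w x * ?C x = 0" if "x \<notin> S \<inter> K" for x
      using that w K by auto
    fix F assume F: "finite F" "F \<subseteq> M"
    have translates: "(\<lambda>y. \<phi> (s + y) * cnj (\<phi> (t + y))) \<in> Cc" for s t
      by (intro Cc_mult_left \<phi> Cc_continuous Cc_cnj Cc_translate)
    let ?q = "\<lambda>y. \<Sum>s\<in>F. \<Sum>t\<in>F. w (s - t) * (\<phi> (s + y) * cnj (\<phi> (t + y)))"
    have "(\<Sum>s\<in>F. \<Sum>t\<in>F. w (s - t) * ?C (s - t)) = \<theta> ?q"
      by (simp add: convolution_reflected_conj[OF \<theta> \<phi>] Cc_sum Cc_cmult translates
          radon_measure_sum[OF haar_measure_imp_radon[OF \<theta>]]
          radon_measure_cmult[OF haar_measure_imp_radon[OF \<theta>]])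
    also have "\<dots> \<in> \<real>\<^sub>\<ge>\<^sub>0"
    proof (rule haar_measure_nonneg[OF \<theta>])
      show "?q \<in> Cc"
        by (intro Cc_sum Cc_cmult translates)
      have "(\<Sum>s\<in>F. \<Sum>t\<in>F. \<phi> (s + y) * cnj (\<phi> (t + y)) * w (s - t)) \<in> \<real>\<^sub>\<ge>\<^sub>0" for y
        using pd F unfolding positive_definite_on_def by simp
      then show "?q y \<in> \<real>\<^sub>\<ge>\<^sub>0" for y
        by (simp add: mult.commute)
    qed
    finally show "(\<Sum>s\<in>F. \<Sum>t\<in>F. w (s - t) * ?C (s - t)) \<in> \<real>\<^sub>\<ge>\<^sub>0" .
  qed
  finally show "dirac_comb S w ?C \<in> \<real>\<^sub>\<ge>\<^sub>0" .
qed


section \<open>Recovering the coefficients of a comb from narrow bumps\<close>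

lemma ex_difference_nhd:
  fixes V :: "'a::topological_group_add set"
  assumes "open V" "0 \<in> V"
  shows "\<exists>U. open U \<and> 0 \<in> U \<and> (\<forall>a\<in>U. \<forall>b\<in>U. a - b \<in> V)"
proof -
  have "continuous_on UNIV (\<lambda>p::'a \<times> 'a. fst p - snd p)"
    by (intro continuous_intros)
  then have "open ((\<lambda>p. fst p - snd p) -` V)"
    using assms by (simp add: continuous_on_open_vimage)
  moreover have "(0, 0) \<in> (\<lambda>p. fst p - snd p) -` V"
    using assms by simp
  ultimately obtain A B where AB: "open A" "open B" "(0, 0) \<in> A \<times> B"
    "A \<times> B \<subseteq> (\<lambda>p. fst p - snd p) -` V"
    by (rule open_prod_elim)
  have "a - b \<in> V" if "a \<in> A \<inter> B" "b \<in> A \<inter> B" for a b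
    using AB(4) that by (auto dest!: subsetD[where c = "(a, b)"])
  then show ?thesis
    using AB by (intro exI[of _ "A \<inter> B"]) auto
qed

text \<open>Within a compact neighbourhood of 0, only finitely many nonzero values of
  \<open>a - b\<close> can carry some \<open>d\<close> in \<open>D\<close> to a point of
  \<open>S\<close>. Deleting them leaves an open neighbourhood of 0, and \<open>U\<close> is taken
  so small that its differences stay in it.\<close>

lemma ex_separating_nhd:
  fixes S D :: "'a::lcag set"
  assumes fin: "\<And>K. compact K \<Longrightarrow> finite (S \<inter> K)" and "finite D"
  obtains U where "open U" "0 \<in> U"
    "\<And>a b d. a \<in> U \<Longrightarrow> b \<in> U \<Longrightarrow> d \<in> D \<Longrightarrow> d + (a - b) \<in> S \<Longrightarrow> a = b"
proof -
  obtain V K :: "'a set" where VK: "open V" "compact K" "0 \<in> V" "V \<subseteq> K"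
    using locally_compact by blast
  \<comment> \<open>The forbidden differences; 0 is taken out because \<open>a = b\<close> remains
    allowed.\<close>
  define E where "E = (\<Union>d\<in>D. (\<lambda>s. s - d) ` (S \<inter> (+) d ` K)) - {0}"
  have "finite E"
    unfolding E_def using \<open>finite D\<close> VK(2)
    by (intro finite_Diff finite_UN_I finite_imageI fin compact_continuous_image continuous_intros) auto
  then have "open (V - E)" "0 \<in> V - E"
    using VK unfolding E_def by (auto intro: open_Diff finite_imp_closed)
  then obtain U where U: "open U" "0 \<in> U" "\<And>a b. a \<in> U \<Longrightarrow> b \<in> U \<Longrightarrow> a - b \<in> V - E"
    using ex_difference_nhd by metis
  show thesis
  proof (rule that[OF U(1,2)])
    fix a b d assume *: "a \<in> U" "b \<in> U" "d \<in> D" "d + (a - b) \<in> S"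
    then have ab: "a - b \<in> V - E"
      using U(3) by simp
    show "a = b"
    proof (rule ccontr)
      assume "a \<noteq> b"
      moreover have "a - b \<in> (\<lambda>s. s - d) ` (S \<inter> (+) d ` K)"
        using * ab VK(4) by (intro image_eqI[of _ _ "d + (a - b)"]) auto
      ultimately have "a - b \<in> E"
        unfolding E_def using *(3) by auto
      with ab show False
        by simp
    qed
  qed
qed

text \<open>Test the comb on the combination of bumps centred at the points \<open>s\<close> of
  \<open>F\<close> with coefficients \<open>c s\<close>. For narrow bumps, a pair \<open>s\<close>,
  \<open>t\<close> contributes to the convolution at a point \<open>x\<close> of \<open>S\<close>
  only if \<open>x = s - t\<close>, and then by \<open>c s * cnj (c t)\<close> times a fixed
  positive constant.\<close>

lemma positive_definite_dirac_combD:
  fixes S :: "'a::lcag set"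
  assumes \<theta>: "haar_measure \<theta>"
    and fin: "\<And>K. compact K \<Longrightarrow> finite (S \<inter> K)"
    and w: "\<And>x. x \<notin> S \<Longrightarrow> w x = 0"
    and pd: "positive_definite_measure \<theta> (dirac_comb S w)"
  shows "positive_definite_on M w"
  unfolding positive_definite_on_def
proof (intro allI impI)
  fix F :: "'a set" and c :: "'a \<Rightarrow> complex"
  assume F: "finite F"
  define D where "D = (\<lambda>p. fst p - snd p) ` (F \<times> F)"
  have D: "finite D"
    unfolding D_def using F by simp
  obtain U where U: "open U" "0 \<in> U"
    "\<And>a b d. a \<in> U \<Longrightarrow> b \<in> U \<Longrightarrow> d \<in> D \<Longrightarrow> d + (a - b) \<in> S \<Longrightarrow> a = b"
    using ex_separating_nhd[OF fin D] by blast
  obtain g :: "'a \<Rightarrow> real" where g: "continuous_on UNIV g" "\<And>x. g x \<ge> 0" "g 0 = 1"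
    "\<And>x. x \<notin> U \<Longrightarrow> g x = 0" "(\<lambda>x. of_real (g x)) \<in> Cc"
    using ex_bump_function[OF U(1,2)] by blast
  \<comment> \<open>The overlap integral of a bump with itself, positive by
    \<open>haar_measure_nonzero\<close>; it is the common factor of all contributions.\<close>
  define \<kappa> where "\<kappa> = \<theta> (\<lambda>x. of_real (g x * g x))"
  have gg: "(\<lambda>x. complex_of_real (g x * g x)) \<in> Cc"
    using Cc_mult_left[OF g(5) Cc_continuous[OF g(5)]] by simp
  have "\<kappa> \<in> \<real>\<^sub>\<ge>\<^sub>0"
    unfolding \<kappa>_def by (intro haar_measure_nonneg[OF \<theta> gg]) (simp add: complex_nonneg_Reals_iff)
  moreover have "\<kappa> \<noteq> 0"
    unfolding \<kappa>_def using g by (intro haar_measure_nonzero[OF \<theta> _ gg] continuous_intros) auto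
  ultimately have \<kappa>: "Re \<kappa> > 0" "\<kappa> = of_real (Re \<kappa>)"
    by (auto simp: complex_nonneg_Reals_iff complex_eq_iff)
  define u where "u s y = complex_of_real (g (- s + y))" for s y
  have u: "u s \<in> Cc" for s
    unfolding u_def using Cc_translate[OF g(5)] .
  \<comment> \<open>The bump is real, so conjugation disappears, and reflection combined with the
    shift by \<open>x\<close> moves its centre to \<open>x + s\<close>.\<close>
  have cnj_u: "cnj (u s (- (x - y))) = u (x + s) y" for s x y
    unfolding u_def by (simp add: algebra_simps)
  define \<phi> where "\<phi> y = (\<Sum>s\<in>F. c s * u s y)" for y
  have \<phi>: "\<phi> \<in> Cc"
    unfolding \<phi>_def by (intro Cc_sum Cc_cmult u)
  let ?C = "convolution \<theta> \<phi> (reflected_conj \<phi>)"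
  let ?a = "\<lambda>s t x. \<theta> (\<lambda>y. u s y * u (x + t) y)"
  have pair: "(\<lambda>y. u s y * u t y) \<in> Cc" for s t
    by (intro Cc_mult_left u Cc_continuous)
  have C_eq: "?C x = (\<Sum>s\<in>F. \<Sum>t\<in>F. c s * cnj (c t) * ?a s t x)" for x
  proof -
    have "?C x = \<theta> (\<lambda>y. \<Sum>s\<in>F. \<Sum>t\<in>F. c s * cnj (c t) * (u s y * u (x + t) y))"
      unfolding convolution_def reflected_conj_def \<phi>_def
      by (simp only: sum_product cnj_sum complex_cnj_mult cnj_u ac_simps)
    then show ?thesis
      by (simp add: Cc_sum Cc_cmult pair radon_measure_sum[OF haar_measure_imp_radon[OF \<theta>]]
          radon_measure_cmult[OF haar_measure_imp_radon[OF \<theta>]])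
  qed
  \<comment> \<open>If the bumps centred at \<open>s\<close> and \<open>x + t\<close> overlap at
    \<open>y\<close>, then \<open>x\<close> is \<open>s - t\<close> plus a difference of two points
    of \<open>U\<close>. Since \<open>x\<close> lies in \<open>S\<close>, the choice of
    \<open>U\<close> makes these two points equal, so \<open>x = s - t\<close>.\<close>
  have a_eq: "?a s t x = (if x = s - t then \<kappa> else 0)" if "s \<in> F" "t \<in> F" "x \<in> S" for s t x
  proof (cases "x = s - t")
    case True
    then show ?thesis
      unfolding \<kappa>_def u_def using haar_measure_translate[OF \<theta> gg, of "- s"] by simp
  next
    case False
    have "u s y * u (x + t) y = 0" for y
    proof (rule ccontr)
      assume "\<not> ?thesis"
      then have "- s + y \<in> U" "- (x + t) + y \<in> U"
        using g(4) unfolding u_def by auto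
      moreover have "s - t \<in> D"
        unfolding D_def using that by force
      moreover have "(s - t) + ((- s + y) - (- (x + t) + y)) = x"
        by (simp add: algebra_simps)
      ultimately have "- s + y = - (x + t) + y"
        using U(3) that(3) by metis
      then have "x = s - t"
        by (simp add: algebra_simps)
      with False show False ..
    qed
    then have "(\<lambda>y. u s y * u (x + t) y) = (\<lambda>y. 0)"
      by (simp add: fun_eq_iff)
    then show ?thesis
      using False radon_measure_zero[OF haar_measure_imp_radon[OF \<theta>]] by simp
  qed
  have C_S: "?C x = (\<Sum>s\<in>F. \<Sum>t\<in>F. if x = s - t then c s * cnj (c t) * \<kappa> else 0)" if "x \<in> S" for x
    unfolding C_eq using that by (intro sum.cong refl) (simp add: a_eq)
  have SD: "finite (S \<inter> D)"
    using D by simp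
  have "dirac_comb S w ?C = (\<Sum>x\<in>S \<inter> D. w x * ?C x)"
  proof (rule dirac_comb_eq_sum[OF SD])
    fix x assume x: "x \<in> S - S \<inter> D"
    then have "x \<noteq> s - t" if "s \<in> F" "t \<in> F" for s t
      using that unfolding D_def by force
    with x show "?C x = 0"
      by (simp add: C_S)
  qed simp
  also have "\<dots> = (\<Sum>x\<in>S \<inter> D. \<Sum>s\<in>F. \<Sum>t\<in>F. if x = s - t then c s * cnj (c t) * \<kappa> * w (s - t) else 0)"
    by (intro sum.cong refl) (simp add: C_S sum_distrib_left if_distrib mult.commute cong: if_cong)
  also have "\<dots> = (\<Sum>s\<in>F. \<Sum>t\<in>F. \<Sum>x\<in>S \<inter> D. if x = s - t then c s * cnj (c t) * \<kappa> * w (s - t) else 0)"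
    by (subst sum.swap) (intro sum.cong refl sum.swap)
  also have "\<dots> = (\<Sum>s\<in>F. \<Sum>t\<in>F. c s * cnj (c t) * \<kappa> * w (s - t))"
  \<comment> \<open>If \<open>s - t\<close> is not in \<open>S\<close>, the inner sum has no
    matching term, in agreement with \<open>w (s - t) = 0\<close>.\<close>
  proof (intro sum.cong refl)
    fix s t assume "s \<in> F" "t \<in> F"
    then have "s - t \<in> D"
      unfolding D_def by force
    then show "(\<Sum>x\<in>S \<inter> D. if x = s - t then c s * cnj (c t) * \<kappa> * w (s - t) else 0)
        = c s * cnj (c t) * \<kappa> * w (s - t)"
      using SD w[of "s - t"] by (simp add: sum.delta)
  qed
  also have "\<dots> = \<kappa> * (\<Sum>s\<in>F. \<Sum>t\<in>F. c s * cnj (c t) * w (s - t))"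
    by (simp add: sum_distrib_left ac_simps)
  finally have "dirac_comb S w ?C = of_real (Re \<kappa>) * (\<Sum>s\<in>F. \<Sum>t\<in>F. c s * cnj (c t) * w (s - t))"
    using \<kappa>(2) by simp
  moreover have "dirac_comb S w ?C \<in> \<real>\<^sub>\<ge>\<^sub>0"
    using pd \<phi> unfolding positive_definite_measure_def by blast
  ultimately show "(\<Sum>s\<in>F. \<Sum>t\<in>F. c s * cnj (c t) * w (s - t)) \<in> \<real>\<^sub>\<ge>\<^sub>0"
    using \<kappa>(1) by (simp add: complex_nonneg_Reals_iff zero_le_mult_iff)
qed

text \<open>The right-hand side is purely algebraic, so it can be compared between the two groups.
  \<open>M\<close> is kept apart from \<open>S\<close> because a weak model set is in general not a
  subgroup, while the projected lattice containing it may fail to be locally finite.\<close>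

lemma positive_definite_dirac_comb_iff:
  fixes S M :: "'a::lcag set"
  assumes "haar_measure \<theta>" and "\<And>K. compact K \<Longrightarrow> finite (S \<inter> K)"
    and "add_subgroup M" "S \<subseteq> M" and "\<And>x. x \<notin> S \<Longrightarrow> w x = 0"
  shows "positive_definite_measure \<theta> (dirac_comb S w) \<longleftrightarrow> positive_definite_on M w"
proof
  assume pd: "positive_definite_measure \<theta> (dirac_comb S w)"
  show "positive_definite_on M w"
    by (rule positive_definite_dirac_combD[OF assms(1) _ _ pd]) (simp_all add: assms)
next
  assume pd: "positive_definite_on M w"
  show "positive_definite_measure \<theta> (dirac_comb S w)"
    by (rule positive_definite_dirac_combI[OF assms(1) _ assms(3,4) _ pd]) (simp_all add: assms)
qed


section \<open>Model sets\<close>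

text \<open>Isolation of 0 spreads by translation: two points of \<open>M\<close> in the same small
  translate differ by an element of \<open>T \<inter> M = {0}\<close>. So each translate holds at
  most one point of \<open>M\<close>, and finitely many translates cover \<open>K\<close>.\<close>

lemma discrete_add_subgroup_Int_compact:
  fixes M K :: "'a::lcag set"
  assumes M: "add_subgroup M" and "discrete M" and K: "compact K"
  shows "finite (M \<inter> K)"
proof -
  have "0 \<in> M"
    using M unfolding add_subgroup_def by simp
  then obtain T where T: "open T" "T \<inter> M = {0}"
    using \<open>discrete M\<close> unfolding discrete_def isolated_in_def by blast
  then have "0 \<in> T"
    by blast
  then obtain U where U: "open U" "0 \<in> U" "\<And>a b. a \<in> U \<Longrightarrow> b \<in> U \<Longrightarrow> a - b \<in> T"
    using ex_difference_nhd[OF T(1)] by metis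
  define N where "N k = (\<lambda>x. - k + x) -` U" for k
  have "open (N k)" for k
  proof -
    have "continuous_on UNIV (\<lambda>x. - k + x)"
      by (intro continuous_intros)
    then show ?thesis
      unfolding N_def by (rule open_vimage[OF U(1)])
  qed
  moreover have "K \<subseteq> (\<Union>k\<in>K. N k)"
    using U unfolding N_def by auto
  ultimately obtain I where I: "I \<subseteq> K" "finite I" "K \<subseteq> (\<Union>k\<in>I. N k)"
    using compactE_image[OF K, of K N] by blast
  have "finite (M \<inter> N k)" for k
  proof -
    have eq: "x = y" if "x \<in> M \<inter> N k" "y \<in> M \<inter> N k" for x y
    proof -
      have "(- k + x) - (- k + y) \<in> T"
        using that unfolding N_def by (intro U(3)) auto
      then have "x - y \<in> T"
        by (simp add: algebra_simps)
      moreover have "x - y \<in> M"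
        using that add_subgroup_diff[OF M] by auto
      ultimately have "x - y \<in> T \<inter> M"
        by blast
      then show ?thesis
        unfolding T(2) by simp
    qed
    show ?thesis
    proof (cases "M \<inter> N k = {}")
      case False
      then obtain x where "x \<in> M \<inter> N k"
        by blast
      then have "M \<inter> N k \<subseteq> {x}"
        using eq[of _ x] by blast
      then show ?thesis
        by (rule finite_subset) simp
    qed simp
  qed
  then have "finite (\<Union>k\<in>I. M \<inter> N k)"
    using I by blast
  moreover have "M \<inter> K \<subseteq> (\<Union>k\<in>I. M \<inter> N k)"
    using I by blast
  ultimately show ?thesis
    by (rule rev_finite_subset)
qed

text \<open>The points in question are first components of lattice points in
  \<open>K \<times> W\<close>, which is compact because the window is.\<close>

lemma model_set_Int_compact:
  fixes \<L> :: "('g::lcag \<times> 'h::lcag) set"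
  assumes L: "cut_and_project_scheme \<L>" and "compact W" "compact K"
  shows "finite (model_set \<L> W \<inter> K)"
proof (rule finite_subset)
  have inj: "inj_on fst \<L>"
    using L unfolding cut_and_project_scheme_def by simp
  show "model_set \<L> W \<inter> K \<subseteq> fst ` (\<L> \<inter> (K \<times> W))"
  proof
    fix x assume "x \<in> model_set \<L> W \<inter> K"
    then obtain p where p: "p \<in> \<L>" "x = fst p" "star_map \<L> (fst p) \<in> W" "x \<in> K"
      unfolding model_set_def by auto
    then have "p \<in> K \<times> W"
      unfolding star_map_def by (simp add: the_inv_into_f_f[OF inj] mem_Times_iff)
    with p show "x \<in> fst ` (\<L> \<inter> (K \<times> W))"
      by blast
  qed
  show "finite (fst ` (\<L> \<inter> (K \<times> W)))"
    using L \<open>compact W\<close> \<open>compact K\<close> unfolding cut_and_project_scheme_def lattice_subgroup_def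
    by (intro finite_imageI discrete_add_subgroup_Int_compact compact_Times) auto
qed

lemma add_subgroup_fst_image:
  fixes M :: "('g::group_add \<times> 'h::group_add) set"
  assumes "add_subgroup M"
  shows "add_subgroup (fst ` M)"
  unfolding add_subgroup_def
proof (intro conjI ballI)
  show "0 \<in> fst ` M"
    using assms unfolding add_subgroup_def by (metis fst_zero image_eqI)
  show "x + y \<in> fst ` M" if "x \<in> fst ` M" "y \<in> fst ` M" for x y
    using that assms unfolding add_subgroup_def by (metis (no_types, lifting) fst_add image_iff)
  show "- x \<in> fst ` M" if "x \<in> fst ` M" for x
    using that assms unfolding add_subgroup_def by (metis (no_types, lifting) fst_uminus image_iff)
qed

text \<open>Injectivity makes \<open>fst\<close> a group isomorphism of \<open>M\<close> onto its
  image, which carries quadratic sums to quadratic sums. The value 0 off \<open>M\<close> matches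
  the form required by \<open>positive_definite_dirac_comb_iff\<close>, and it never shows in the
  sums because differences of points of \<open>M\<close> stay in \<open>M\<close>.\<close>

lemma positive_definite_on_fst_image:
  fixes M :: "('g::group_add \<times> 'h::group_add) set"
  assumes M: "add_subgroup M" and inj: "inj_on fst M"
  shows "positive_definite_on (fst ` M) f \<longleftrightarrow>
    positive_definite_on M (\<lambda>p. if p \<in> M then f (fst p) else 0)" (is "?l \<longleftrightarrow> ?r")
proof -
  have sum_eq: "(\<Sum>s\<in>fst ` F. \<Sum>t\<in>fst ` F. c s * cnj (c t) * f (s - t)) =
      (\<Sum>s\<in>F. \<Sum>t\<in>F. c (fst s) * cnj (c (fst t)) * (if s - t \<in> M then f (fst (s - t)) else 0))"
    if "F \<subseteq> M" for F c
  proof -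
    have "inj_on fst F"
      using inj that by (rule inj_on_subset)
    moreover have "s - t \<in> M" if "s \<in> F" "t \<in> F" for s t
      using that \<open>F \<subseteq> M\<close> add_subgroup_diff[OF M] by blast
    ultimately show ?thesis
      by (simp add: sum.reindex cong: sum.cong)
  qed
  show ?thesis
  proof
    assume l: ?l
    show ?r
      unfolding positive_definite_on_def
    proof (intro allI impI)
      fix F and c :: "'g \<times> 'h \<Rightarrow> complex"
      assume F: "finite F" "F \<subseteq> M"
      \<comment> \<open>The coefficients move to the image along the inverse of \<open>fst\<close>;
        only their values on the image of \<open>F\<close> matter.\<close>
      define d where "d = c \<circ> the_inv_into M fst"
      have d: "d (fst s) = c s" if "s \<in> F" for s
        using that F(2) the_inv_into_f_f[OF inj, of s] unfolding d_def by auto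
      have "(\<Sum>s\<in>fst ` F. \<Sum>t\<in>fst ` F. d s * cnj (d t) * f (s - t)) \<in> \<real>\<^sub>\<ge>\<^sub>0"
        using l F unfolding positive_definite_on_def by (simp add: image_mono)
      then show "(\<Sum>s\<in>F. \<Sum>t\<in>F. c s * cnj (c t) * (if s - t \<in> M then f (fst (s - t)) else 0)) \<in> \<real>\<^sub>\<ge>\<^sub>0"
        unfolding sum_eq[OF F(2)] by (simp add: d cong: sum.cong)
    qed
  next
    assume r: ?r
    show ?l
      unfolding positive_definite_on_def
    proof (intro allI impI)
      fix F and c :: "'g \<Rightarrow> complex"
      assume "finite F" "F \<subseteq> fst ` M"
      then obtain F' where F': "F' \<subseteq> M" "finite F'" "F = fst ` F'"
        using finite_subset_image by metis
      show "(\<Sum>s\<in>F. \<Sum>t\<in>F. c s * cnj (c t) * f (s - t)) \<in> \<real>\<^sub>\<ge>\<^sub>0"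
        unfolding F'(3) sum_eq[OF F'(1)] using r F' unfolding positive_definite_on_def by simp
    qed
  qed
qed

theorem proposition3p5:
  fixes \<L> :: "('g::{lcag, second_countable_topology} \<times> 'h::lcag) set"
    and W :: "'h set"
    and f :: "'g \<Rightarrow> complex"
    and \<theta>\<^sub>G :: "('g \<Rightarrow> complex) \<Rightarrow> complex"
    and \<theta>\<^sub>G\<^sub>H :: "('g \<times> 'h \<Rightarrow> complex) \<Rightarrow> complex"
  assumes "cut_and_project_scheme \<L>"
    and "compact W"
    and "\<And>x. x \<notin> model_set \<L> W \<Longrightarrow> f x = 0"
    and "haar_measure \<theta>\<^sub>G"
    and "haar_measure \<theta>\<^sub>G\<^sub>H"
  shows "positive_definite_measure \<theta>\<^sub>G (dirac_comb (model_set \<L> W) f) \<longleftrightarrow>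
         positive_definite_measure \<theta>\<^sub>G\<^sub>H (dirac_comb \<L> (\<lambda>p. f (fst p)))"
proof -
  \<comment> \<open>A point off the lattice can share its first component with a lattice point, so
    \<open>f (fst p)\<close> may be nonzero there. Cutting it off leaves the comb over \<L>
    unchanged.\<close>
  let ?w = "\<lambda>p. if p \<in> \<L> then f (fst p) else 0"
  have \<L>: "add_subgroup \<L>" "discrete \<L>" "inj_on fst \<L>"
    using assms(1) unfolding cut_and_project_scheme_def lattice_subgroup_def by auto
  have fin: "finite (model_set \<L> W \<inter> K)" if "compact K" for K
    by (rule model_set_Int_compact[OF assms(1,2) that])
  have finL: "finite (\<L> \<inter> K)" if "compact K" for K
    by (rule discrete_add_subgroup_Int_compact[OF \<L>(1,2) that])
  have sub: "model_set \<L> W \<subseteq> fst ` \<L>"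
    unfolding model_set_def by blast
  \<comment> \<open>The test points range over the whole projected lattice, although
    \<open>f\<close> lives on the weak model set.\<close>
  have "positive_definite_measure \<theta>\<^sub>G (dirac_comb (model_set \<L> W) f) \<longleftrightarrow>
      positive_definite_on (fst ` \<L>) f"
    by (rule positive_definite_dirac_comb_iff[OF assms(4) _ add_subgroup_fst_image[OF \<L>(1)] sub])
      (simp_all add: fin assms(3))
  also have "\<dots> \<longleftrightarrow> positive_definite_on \<L> ?w"
    by (rule positive_definite_on_fst_image[OF \<L>(1,3)])
  also have "\<dots> \<longleftrightarrow> positive_definite_measure \<theta>\<^sub>G\<^sub>H (dirac_comb \<L> ?w)"
    by (rule positive_definite_dirac_comb_iff[OF assms(5) _ \<L>(1), symmetric]) (simp_all add: finL)
  also have "dirac_comb \<L> ?w = dirac_comb \<L> (\<lambda>p. f (fst p))"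
    unfolding dirac_comb_def by (intro ext infsum_cong) simp
  finally show ?thesis .
qed

end
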